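(* Let $\{u_n\}$, $\{\alpha_n\}$, and $\{\beta_n\}$ be sequences of real numbers with $\alpha_n \le \beta_n \le \alpha_n+1$ for all $n$. For every pair of positive integers $N$ and $H$, \[ |D_N| \le \frac{N}{H+1} + \sum_{h=1}^H \big( 1 + \pi h\,( V_N(\alpha) + V_N(\beta)) \big) \bigg( \frac{2-c}{H+1} + \frac{c}{h} \bigg) M_N(h), \] where $c = \frac{16}{7\pi}$ and \[ M_N(h) = \max_{1\le T\le N} \bigg| \sum_{n=1}^T e(hu_n) \bigg|. \]
   Context: Write $e(y)=e^{2\pi i y}$. Define \[ Z_N = \#\{1\le n\le N : u_n \in [\alpha_n,\beta_n] \pmod 1\}, \] where $u_n\in[\alpha_n,\beta_n] \pmod 1$ means that there is a real number $z$ with $\alpha_n\le z\le\beta_n$ and $u_n - z\in\mathbb{Z}$, and define \[ D_N = Z_N - \sum_{n=1}^N (\beta_n-\alpha_n). \] For a sequence $s=\{s_n\}$ of real numbers, $V_N(s) = \sum_{n=1}^{N-1} \|s_{n+1}-s_n\|$ is its total variation modulo $1$, where $\|y\| = \min_{z\in\mathbb{Z}}|y-z|$. *)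

theory Defs
  imports "HOL-Analysis.Analysis"
begin

text \<open>Sequences are functions on \<^typ>\<open>nat\<close> of which only the values at indices
  \<open>n \<ge> 1\<close> matter.\<close>

definition e_unit :: "real \<Rightarrow> complex" where
  "e_unit y = exp (2 * of_real pi * \<i> * of_real y)"

definition in_interval_mod1 :: "real \<Rightarrow> real \<Rightarrow> real \<Rightarrow> bool" where
  "in_interval_mod1 x a b \<longleftrightarrow> (\<exists>z. a \<le> z \<and> z \<le> b \<and> x - z \<in> \<int>)"

definition count_mod1 ::
    "(nat \<Rightarrow> real) \<Rightarrow> (nat \<Rightarrow> real) \<Rightarrow> (nat \<Rightarrow> real) \<Rightarrow> nat \<Rightarrow> nat" where
  "count_mod1 u \<alpha> \<beta> N = card {n \<in> {1..N}. in_interval_mod1 (u n) (\<alpha> n) (\<beta> n)}"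

definition discrepancy ::
    "(nat \<Rightarrow> real) \<Rightarrow> (nat \<Rightarrow> real) \<Rightarrow> (nat \<Rightarrow> real) \<Rightarrow> nat \<Rightarrow> real" where
  "discrepancy u \<alpha> \<beta> N = real (count_mod1 u \<alpha> \<beta> N) - (\<Sum>n=1..N. \<beta> n - \<alpha> n)"

text \<open>The index set is infinite, so the minimum is written as an infimum; the lemma below shows
  that it is attained.\<close>

definition dist_int :: "real \<Rightarrow> real" where
  "dist_int y = (INF z::int. \<bar>y - of_int z\<bar>)"

lemma dist_int_is_min:
  "(\<exists>z::int. dist_int y = \<bar>y - of_int z\<bar>) \<and> (\<forall>z::int. dist_int y \<le> \<bar>y - of_int z\<bar>)"
proof -
  have le: "\<bar>y - of_int (round y)\<bar> \<le> \<bar>y - of_int z\<bar>" for z :: int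
    using round_diff_minimal[of y z] by simp
  have "dist_int y = \<bar>y - of_int (round y)\<bar>"
    unfolding dist_int_def by (rule cInf_eq_minimum) (use le in auto)
  then show ?thesis using le by auto
qed

definition total_variation_mod1 :: "(nat \<Rightarrow> real) \<Rightarrow> nat \<Rightarrow> real" where
  "total_variation_mod1 s N = (\<Sum>n=1..<N. dist_int (s (n + 1) - s n))"

definition max_exp_sum :: "(nat \<Rightarrow> real) \<Rightarrow> nat \<Rightarrow> nat \<Rightarrow> real" where
  "max_exp_sum u N h =
     Max ((\<lambda>T. norm (\<Sum>n=1..T. e_unit (real h * u n))) ` {1..N})"

end

theory Submission
  imports Defs
begin

text \<open>
  Put \<open>M = H + 1\<close>. Vaaler's trigonometric polynomial \<open>B\<close> of degree at most \<open>H\<close> has mean \<open>1 / (2 * M)\<close> and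
  majorizes the sawtooth \<open>x - \<lfloor>x\<rfloor> - 1 / 2\<close>, including both one-sided limits at the integers. Then
  \<open>\<beta> - \<alpha> + B (u - \<beta>) + B (\<alpha> - u)\<close> majorizes the indicator of \<open>[\<alpha>, \<beta>]\<close> modulo 1 at \<open>u\<close>, and
  \<open>\<beta> - \<alpha> - B (\<beta> - u) - B (u - \<alpha>)\<close> minorizes it. Summed over \<open>n\<close>, the terms of frequency \<open>h\<close>
  are exponential sums of \<open>h u\<^sub>n\<close> twisted by \<open>e(- h \<beta>\<^sub>n)\<close> or \<open>e(- h \<alpha>\<^sub>n)\<close>; summation by parts removes
  the twist at the cost of the factor \<open>1 + 2 \<pi> h V\<^sub>N\<close>.

  The majorization of the sawtooth rests on the concavity of \<open>t cot t\<close>: up to the factor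
  \<open>sin\<^sup>2 (\<pi> M x)\<close>, the difference is the error of a Riemann sum of its decreasing derivative.
\<close>

section \<open>Trigonometric kernels and sums over rational angles\<close>

text \<open>With the denominator cleared, passing from \<open>n\<close> to \<open>n + 1\<close> adds
  \<open>(sin a)^2\<close> times the Dirichlet kernel \<open>1 + 2 * S\<close>. One factor
  \<open>sin a\<close> turns the kernel into \<open>sin ((2 * n + 1) * a)\<close>, and
  \<open>sin a * sin ((2 * n + 1) * a)\<close> is exactly the increment of the squared sine.\<close>

lemma fejer_sum:
  fixes a :: real
  assumes "sin a \<noteq> 0"
  shows "real M + 2 * (\<Sum>h=1..<M. (real M - real h) * cos (2 * real h * a))
       = (sin (real M * a))\<^sup>2 / (sin a)\<^sup>2"
proof -
  have prod: "2 * (sin a * cos x) = sin (x + a) - sin (x - a)" for x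
    by (simp add: sin_add sin_diff)
  have dirichlet: "sin a * (1 + 2 * (\<Sum>h=1..n. cos (2 * real h * a))) = sin ((2 * real n + 1) * a)" for n
  proof (induction n)
    case (Suc n)
    have "2 * (sin a * cos (2 * real (Suc n) * a)) = sin ((2 * real (Suc n) + 1) * a) - sin ((2 * real n + 1) * a)"
      using prod[of "2 * real (Suc n) * a"] by (simp add: algebra_simps)
    then show ?case using Suc by (simp add: algebra_simps)
  qed simp
  have "(real M + 2 * (\<Sum>h=1..<M. (real M - real h) * cos (2 * real h * a))) * (sin a)\<^sup>2
       = (sin (real M * a))\<^sup>2"
  proof (induction M)
    case (Suc n)
    define S where "S = (\<Sum>h=1..n. cos (2 * real h * a))"
    have "(\<Sum>h=1..<Suc n. (real (Suc n) - real h) * cos (2 * real h * a))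
        = (\<Sum>h=1..n. (real n - real h) * cos (2 * real h * a)) + S"
      unfolding S_def atLeastLessThanSuc_atLeastAtMost
      by (simp add: algebra_simps sum.distrib[symmetric])
    \<comment> \<open>The top term \<open>h = n\<close> has weight 0.\<close>
    also have "(\<Sum>h=1..n. (real n - real h) * cos (2 * real h * a)) = (\<Sum>h=1..<n. (real n - real h) * cos (2 * real h * a))"
      by (cases n) (simp_all add: atLeastLessThanSuc_atLeastAtMost)
    finally have "(real (Suc n) + 2 * (\<Sum>h=1..<Suc n. (real (Suc n) - real h) * cos (2 * real h * a))) * (sin a)\<^sup>2
      = (sin (real n * a))\<^sup>2 + sin a * (sin a * (1 + 2 * S))"
      using Suc by (simp add: algebra_simps power2_eq_square)
    also have "sin a * (1 + 2 * S) = sin ((2 * real n + 1) * a)"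
      unfolding S_def by (rule dirichlet)
    also have "(sin (real n * a))\<^sup>2 + sin a * sin ((2 * real n + 1) * a) = (sin (real (Suc n) * a))\<^sup>2"
    proof -
      have prods: "2 * (sin a * sin x) = cos (x - a) - cos (x + a)" for x
        by (simp add: cos_add cos_diff)
      have "cos (2 * (real n * a)) - cos (2 * (real (Suc n) * a)) = 2 * (sin a * sin ((2 * real n + 1) * a))"
        using prods[of "(2 * real n + 1) * a"] by (simp add: algebra_simps)
      then show ?thesis unfolding cos_double_sin by simp
    qed
    finally show ?case .
  qed simp
  then show ?thesis using assms by (simp add: field_simps)
qed

text \<open>Because the last term is halved, each induction step adds half of
  \<open>sin (2 * m * a) + sin (2 * (m + 1) * a)\<close>, that is
  \<open>sin ((2 * m + 1) * a) * cos a\<close>. Times \<open>sin a\<close>, this is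
  \<open>cos a\<close> times the increment of the squared sine, as for the Fejer kernel.\<close>

lemma conjugate_dirichlet_sum:
  fixes a :: real
  assumes "sin a \<noteq> 0"
  shows "(\<Sum>h=1..<M. sin (2 * real h * a)) + sin (2 * real M * a) / 2 = (sin (real M * a))\<^sup>2 * cot a"
proof (cases M)
  case (Suc m)
  have "sin a * ((\<Sum>h=1..m. sin (2 * real h * a)) + sin (2 * real (Suc m) * a) / 2)
     = (sin (real (Suc m) * a))\<^sup>2 * cos a"
  proof (induction m)
    case 0
    then show ?case by (simp add: sin_double power2_eq_square)
  next
    case (Suc n)
    have prods: "2 * (sin a * sin x) = cos (x - a) - cos (x + a)" for x
      by (simp add: cos_add cos_diff)
    have prodc: "2 * (sin x * cos a) = sin (x - a) + sin (x + a)" for x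
      by (simp add: sin_add sin_diff)
    have "cos (2 * (real (Suc n) * a)) - cos (2 * (real (Suc (Suc n)) * a))
         = 2 * (sin a * sin ((2 * real n + 3) * a))"
      using prods[of "(2 * real n + 3) * a"] by (simp add: algebra_simps)
    then have 1: "(sin (real (Suc (Suc n)) * a))\<^sup>2 = (sin (real (Suc n) * a))\<^sup>2 + sin a * sin ((2 * real n + 3) * a)"
      unfolding cos_double_sin by simp
    have 2: "sin (2 * real (Suc n) * a) + sin (2 * real (Suc (Suc n)) * a) = 2 * (sin ((2 * real n + 3) * a) * cos a)"
      using prodc[of "(2 * real n + 3) * a"] by (simp add: algebra_simps)
    have "sin a * ((\<Sum>h=1..Suc n. sin (2 * real h * a)) + sin (2 * real (Suc (Suc n)) * a) / 2)
        = sin a * ((\<Sum>h=1..n. sin (2 * real h * a)) + sin (2 * real (Suc n) * a) / 2)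
         + sin a * (sin (2 * real (Suc n) * a) + sin (2 * real (Suc (Suc n)) * a)) / 2"
      by (simp add: field_simps)
    also have "\<dots> = (sin (real (Suc (Suc n)) * a))\<^sup>2 * cos a"
      unfolding Suc 1 2 by (simp add: field_simps)
    finally show ?case .
  qed
  then show ?thesis using assms Suc
    by (simp add: atLeastLessThanSuc_atLeastAtMost cot_def field_simps)
qed simp

text \<open>Multiplication by \<open>2 * sin b\<close> makes the cosine sum telescope, and the total
  shift \<open>2 * b * M = 2 * pi * h\<close> is a period. The weight \<open>j\<close> is handled by
  Abel summation.\<close>

lemma rational_angle_sums:
  fixes \<theta> :: real
  assumes "0 < h" "h < M"
  defines "b \<equiv> pi * real h / real M"
  shows "(\<Sum>j<M. cos (\<theta> - 2 * b * real j)) = 0"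
    and "(\<Sum>j<M. sin (\<theta> - 2 * b * real j)) = 0"
    and "(\<Sum>j<M. real j * cos (\<theta> - 2 * b * real j)) = - real M / 2 * (cos \<theta> + cot b * sin \<theta>)"
proof -
  have "0 < b" "b < pi" using assms by (auto simp: b_def field_simps)
  then have b: "sin b > 0" by (rule sin_gt_zero)
  have tel: "2 * sin b * cos (\<theta> - 2 * b * real j)
     = sin (\<theta> + b - 2 * b * real j) - sin (\<theta> + b - 2 * b * real (Suc j))" for \<theta> j
  proof -
    have "2 * (sin b * cos x) = sin (x + b) - sin (x - b)" for x
      by (simp add: sin_add sin_diff)
    from this[of "\<theta> - 2 * b * real j"] show ?thesis by (simp add: algebra_simps)
  qed
  have per: "sin (\<theta> + b - 2 * b * real M) = sin (\<theta> + b)" for \<theta>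
  proof -
    have "2 * b * real M = 2 * real h * pi" using assms by (simp add: b_def)
    moreover have "sin (2 * real h * pi) = 0" "cos (2 * real h * pi) = 1"
      using sin_2npi[of h] cos_2npi[of h] by auto
    ultimately show ?thesis by (simp only: sin_diff)
  qed
  have c: "(\<Sum>j<M. cos (\<theta> - 2 * b * real j)) = 0" for \<theta>
  proof -
    have "2 * sin b * (\<Sum>j<M. cos (\<theta> - 2 * b * real j))
       = (\<Sum>j<M. sin (\<theta> + b - 2 * b * real j) - sin (\<theta> + b - 2 * b * real (Suc j)))"
      by (simp only: sum_distrib_left tel)
    also have "\<dots> = 0"
      by (subst sum_lessThan_telescope') (use per[of \<theta>] in simp)
    finally show ?thesis using b by simp
  qed
  then show "(\<Sum>j<M. cos (\<theta> - 2 * b * real j)) = 0" .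
  have s: "(\<Sum>j<M. sin (\<theta> - 2 * b * real j)) = 0" for \<theta>
  proof -
    have "cos (\<theta> - pi / 2 - 2 * b * real j) = sin (\<theta> - 2 * b * real j)" for j
      by (simp add: cos_diff sin_diff)
    then show ?thesis using c[of "\<theta> - pi / 2"] by simp
  qed
  then show "(\<Sum>j<M. sin (\<theta> - 2 * b * real j)) = 0" .
  have abel: "(\<Sum>j<n. real j * (s j - s (Suc j))) = (\<Sum>j<n. s j) - s 0 - (real n - 1) * s n"
    for n and s :: "nat \<Rightarrow> real"
    by (induction n) (simp_all add: algebra_simps)
  have "2 * sin b * (\<Sum>j<M. real j * cos (\<theta> - 2 * b * real j))
     = (\<Sum>j<M. real j * (2 * sin b * cos (\<theta> - 2 * b * real j)))"
    by (simp add: sum_distrib_left algebra_simps)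
  \<comment> \<open>In \<open>abel\<close> the full sum vanishes and \<open>s M = s 0\<close>, so
    only \<open>- M * s 0\<close> remains.\<close>
  also have "\<dots> = - real M * sin (\<theta> + b)"
    unfolding tel using abel[of "\<lambda>j. sin (\<theta> + b - 2 * b * real j)" M] s[of "\<theta> + b"] per[of \<theta>]
    by (simp add: algebra_simps)
  finally have "(\<Sum>j<M. real j * cos (\<theta> - 2 * b * real j)) = - real M * sin (\<theta> + b) / (2 * sin b)"
    using b by (simp add: field_simps)
  also have "\<dots> = - real M / 2 * (cos \<theta> + cot b * sin \<theta>)"
    using b by (simp add: sin_add cot_def field_simps)
  finally show "(\<Sum>j<M. real j * cos (\<theta> - 2 * b * real j)) = - real M / 2 * (cos \<theta> + cot b * sin \<theta>)" .
qed

section \<open>Concavity of \<open>t cot t\<close>\<close>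

lemma mult_cot_le_one:
  fixes t :: real
  assumes "0 < t" "t < pi"
  shows "t * cot t \<le> 1"
proof -
  have "((\<lambda>x. sin x - x * cos x) has_real_derivative (x * sin x)) (at x)" for x :: real
    by (auto intro!: derivative_eq_intros)
  moreover have "0 \<le> x * sin x" if "0 \<le> x" "x \<le> t" for x
    using that assms by (simp add: sin_ge_zero)
  ultimately have "sin 0 - 0 * cos 0 \<le> sin t - t * cos t"
    using assms by (intro DERIV_nonneg_imp_nondecreasing[of 0 t "\<lambda>x. sin x - x * cos x"]) auto
  moreover have "sin t > 0" using assms by (rule sin_gt_zero)
  ultimately show ?thesis by (simp add: cot_def field_simps)
qed

text \<open>The second derivative of \<open>- t cot t\<close> is
  \<open>2 * (1 - t cot t) / (sin t)^2\<close>, which is nonnegative by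
  \<open>mult_cot_le_one\<close>.\<close>

lemma mult_cot_below_tangent_pos:
  fixes a b :: real
  assumes "a \<in> {0<..<pi}" "b \<in> {0<..<pi}"
  shows "b * cot b - a * cot a \<le> (cot a - a / (sin a)\<^sup>2) * (b - a)"
proof -
  have "convex_on {0<..<pi} (\<lambda>t. - (t * cot t))"
  proof (rule f''_ge0_imp_convex)
    fix t :: real assume t: "t \<in> {0<..<pi}"
    then have s: "sin t > 0" by (simp add: sin_gt_zero)
    then have c: "cos t = cot t * sin t" by (simp add: cot_def)
    show "((\<lambda>t. - (t * cot t)) has_real_derivative - (cot t - t / (sin t)\<^sup>2)) (at t)"
      using s by (auto intro!: derivative_eq_intros DERIV_cot simp: field_simps)
    show "((\<lambda>t. - (cot t - t / (sin t)\<^sup>2)) has_real_derivative 2 * (1 - t * cot t) / (sin t)\<^sup>2) (at t)"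
      using s c by (auto intro!: derivative_eq_intros DERIV_cot simp: field_simps power2_eq_square)
    show "2 * (1 - t * cot t) / (sin t)\<^sup>2 \<ge> 0"
      using mult_cot_le_one[of t] t by simp
  qed simp
  moreover have "((\<lambda>t. - (t * cot t)) has_real_derivative - (cot a - a / (sin a)\<^sup>2)) (at a within {0<..<pi})"
    using assms sin_gt_zero[of a]
    by (auto intro!: derivative_eq_intros has_field_derivative_at_within[OF DERIV_cot] simp: field_simps)
  ultimately have "- (cot a - a / (sin a)\<^sup>2) * (b - a) \<le> - (b * cot b) - - (a * cot a)"
    using assms by (intro convex_on_imp_above_tangent[of "{0<..<pi}"]) (auto simp: interior_open)
  then show ?thesis by (simp add: algebra_simps)
qed

text \<open>Both points avoid 0, where \<open>t * cot t\<close> evaluates to 0 instead of its limit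
  1. On the negative side the function is reflected, being even. Across 0 the claim reduces to
  \<open>b * cot b \<le> 1 \<le> (a / sin a)^2\<close>, since the slope at \<open>a < 0\<close> is
  nonnegative.\<close>

lemma mult_cot_below_tangent:
  fixes a b :: real
  assumes "- pi < a" "a < b" "b < pi" "a \<noteq> 0" "b \<noteq> 0"
  shows "b * cot b - a * cot a \<le> (cot a - a / (sin a)\<^sup>2) * (b - a)"
proof -
  consider "a > 0" | "b < 0" | "a < 0" "b > 0" using assms by linarith
  then show ?thesis
  proof cases
    case 1
    then show ?thesis using assms by (intro mult_cot_below_tangent_pos) auto
  next
    case 2
    then show ?thesis using assms mult_cot_below_tangent_pos[of "-a" "-b"]
      by (simp add: algebra_simps add_divide_distrib diff_divide_distrib)
  next
    case 3
    then have s: "sin (-a) > 0" using assms by (intro sin_gt_zero) auto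
    have "(cot a - a / (sin a)\<^sup>2) * (sin a)\<^sup>2 = sin (2 * a) / 2 - a"
      using s by (simp add: sin_double cot_def power2_eq_square left_diff_distrib)
    also have "\<dots> \<ge> 0" using 3 sin_x_le_x[of "- (2 * a)"] by simp
    finally have "0 \<le> cot a - a / (sin a)\<^sup>2" using s by (simp add: zero_le_mult_iff)
    then have "0 \<le> (cot a - a / (sin a)\<^sup>2) * b" using 3 by simp
    moreover have "(sin a)\<^sup>2 \<le> a\<^sup>2" using abs_sin_x_le_abs_x[of a] by (simp add: abs_le_square_iff)
    then have "1 \<le> a * (a / (sin a)\<^sup>2)"
      using s by (simp add: le_divide_eq_1_pos flip: power2_eq_square)
    moreover have "b * cot b \<le> 1" using 3 assms by (intro mult_cot_le_one)
    ultimately show ?thesis by (simp add: algebra_simps add_divide_distrib diff_divide_distrib)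
  qed
qed

section \<open>Vaaler's majorant of the sawtooth\<close>

text \<open>Cosine coefficients of the Fejer kernel of mean 1, divided by
  \<open>2 * M\<close>.\<close>

definition vaaler_cos :: "nat \<Rightarrow> nat \<Rightarrow> real" where
  "vaaler_cos M h = (1 - real h / real M) / real M"

text \<open>With \<open>t = h / M\<close> this is \<open>1 / (pi * h)\<close>, up to sign the
  Fourier coefficient of the sawtooth, damped by Vaaler's multiplier
  \<open>pi * t * (1 - t) * cot (pi * t) + t\<close>.\<close>

definition vaaler_sin :: "nat \<Rightarrow> nat \<Rightarrow> real" where
  "vaaler_sin M h = ((1 - real h / real M) * cot (pi * real h / real M) + 1 / pi) / real M"

definition sawtooth_majorant :: "nat \<Rightarrow> real \<Rightarrow> real" where
  "sawtooth_majorant M x = 1 / (2 * real M) + (\<Sum>h=1..<M.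
     vaaler_cos M h * cos (2 * pi * real h * x) - vaaler_sin M h * sin (2 * pi * real h * x))"

lemma sawtooth_majorant_periodic:
  assumes "z \<in> \<int>"
  shows "sawtooth_majorant M (x + z) = sawtooth_majorant M x"
proof -
  obtain k where k: "z = of_int k" using assms by (elim Ints_cases)
  have "2 * pi * real h * (x + z) = 2 * pi * real h * x + 2 * pi * of_int (int h * k)" for h
    by (simp add: k algebra_simps)
  moreover have "sin (2 * pi * of_int m) = 0" "cos (2 * pi * of_int m) = 1" for m
    using sin_int_2pin cos_int_2pin by auto
  ultimately show ?thesis
    unfolding sawtooth_majorant_def by (simp only: sin_add cos_add) simp
qed

text \<open>The Fejer kernel interpolates values and the conjugate Dirichlet kernel derivatives at the
  points \<open>j / M\<close>; the cotangents in the coefficients are the discrete Fourier transform of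
  \<open>j \<mapsto> j\<close>.\<close>

lemma sawtooth_majorant_interpolation:
  assumes "sin (pi * real M * x) \<noteq> 0" "M > 0"
  defines "y \<equiv> \<lambda>j. pi * (x - real j / real M)"
  shows "pi * (real M)\<^sup>2 * (sawtooth_majorant M x - (x - 1 / 2))
    = (sin (pi * real M * x))\<^sup>2 *
      ((\<Sum>j<M. cot (y j) - y j / (sin (y j))\<^sup>2) + pi / (sin (pi * x))\<^sup>2 - real M * cot (pi * x))"
proof -
  define S where "S = (sin (pi * real M * x))\<^sup>2"
  define K where "K a = real M + 2 * (\<Sum>h=1..<M. (real M - real h) * cos (2 * real h * a))" for a :: real
  define Q where "Q a = (\<Sum>h=1..<M. sin (2 * real h * a)) + sin (2 * real M * a) / 2" for a :: real
  define b where "b h = pi * real h / real M" for h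
  \<comment> \<open>The points \<open>y j\<close> differ by multiples of \<open>pi / M\<close>, so
    the squared sine in both kernels takes the same value \<open>S\<close> at all of them.\<close>
  have My: "real M * y j = pi * real M * x - real j * pi" for j
    using assms by (simp add: y_def field_simps)
  have Sy: "(sin (real M * y j))\<^sup>2 = S" for j
    unfolding My S_def sin_diff by (simp add: power_mult_distrib flip: power_mult)
  have "S \<noteq> 0" using assms by (simp add: S_def)
  have nz: "sin (y j) \<noteq> 0" for j
  proof
    assume "sin (y j) = 0"
    then obtain k :: int where "y j = of_int k * pi" by (auto simp: sin_zero_iff_int2)
    then have "real M * y j = of_int (int M * k) * pi" by simp
    then have "sin (real M * y j) = 0" unfolding sin_zero_iff_int2 by blast
    then show False using Sy[of j] \<open>S \<noteq> 0\<close> by simp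
  qed
  have K: "S / (sin (y j))\<^sup>2 = K (y j)" for j
    using fejer_sum[OF nz[of j], of M] unfolding K_def Sy by simp
  have Q: "S * cot (y j) = Q (y j)" for j
    using conjugate_dirichlet_sum[OF nz[of j], of M] unfolding Q_def Sy by simp
  have angle: "2 * real h * y j = 2 * pi * real h * x - 2 * b h * real j" for h j
    by (simp add: y_def b_def algebra_simps)
  have "S * ((\<Sum>j<M. cot (y j) - y j / (sin (y j))\<^sup>2) + pi / (sin (pi * x))\<^sup>2 - real M * cot (pi * x))
    = (\<Sum>j<M. S * cot (y j) - y j * (S / (sin (y j))\<^sup>2)) + pi * (S / (sin (y 0))\<^sup>2) - real M * (S * cot (y 0))"
    by (simp add: y_def algebra_simps sum_distrib_left sum_subtractf)
  also have "\<dots> = (\<Sum>j<M. Q (y j)) - (\<Sum>j<M. y j * K (y j)) + pi * K (y 0) - real M * Q (y 0)"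
    unfolding K Q by (simp add: sum_subtractf)
  also have "(\<Sum>j<M. y j * K (y j)) = pi * x * (\<Sum>j<M. K (y j)) - pi / real M * (\<Sum>j<M. real j * K (y j))"
    by (simp add: y_def algebra_simps sum_distrib_left sum_subtractf)
  \<comment> \<open>Summation over \<open>j\<close> kills the frequencies below \<open>M\<close>;
    only the halved term of frequency \<open>M\<close> survives.\<close>
  also have "(\<Sum>j<M. Q (y j)) = real M / 2 * sin (2 * pi * real M * x)"
  proof -
    have "(\<Sum>j<M. Q (y j)) = (\<Sum>j<M. \<Sum>h=1..<M. sin (2 * real h * y j)) + (\<Sum>j<M. sin (2 * real M * y j) / 2)"
      unfolding Q_def by (rule sum.distrib)
    also have "(\<Sum>j<M. \<Sum>h=1..<M. sin (2 * real h * y j)) = (\<Sum>h=1..<M. \<Sum>j<M. sin (2 * real h * y j))"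
      by (rule sum.swap)
    also have "\<dots> = 0"
      unfolding angle b_def by (intro sum.neutral ballI rational_angle_sums(2)) auto
    finally have "(\<Sum>j<M. Q (y j)) = (\<Sum>j<M. sin (2 * real M * y j) / 2)" by simp
    moreover have "sin (2 * real M * y j) = sin (2 * pi * real M * x)" for j
    proof -
      have "2 * real M * y j = 2 * pi * real M * x - 2 * real j * pi"
        using My[of j] by simp
      then show ?thesis by (simp only: sin_diff sin_2npi cos_2npi mult_1_right mult_zero_right diff_zero)
    qed
    ultimately show ?thesis by simp
  qed
  also have "(\<Sum>j<M. K (y j)) = (real M)\<^sup>2"
  proof -
    have "(\<Sum>j<M. \<Sum>h=1..<M. (real M - real h) * cos (2 * real h * y j))
        = (\<Sum>h=1..<M. (real M - real h) * (\<Sum>j<M. cos (2 * real h * y j)))"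
      by (subst sum.swap) (simp add: sum_distrib_left)
    also have "\<dots> = 0"
      unfolding angle b_def by (intro sum.neutral ballI, subst rational_angle_sums(1)) auto
    finally show ?thesis
      unfolding K_def sum.distrib sum_distrib_left[symmetric] by (simp add: power2_eq_square)
  qed
  \<comment> \<open>Here the third part of \<open>rational_angle_sums\<close> brings in the
    cotangents.\<close>
  also have "(\<Sum>j<M. real j * K (y j)) = real M * (real M * (real M - 1) / 2 -
      (\<Sum>h=1..<M. (real M - real h) * (cos (2 * pi * real h * x) + cot (b h) * sin (2 * pi * real h * x))))"
  proof -
    have lin: "(\<Sum>j<n. real j) = real n * (real n - 1) / 2" for n
      by (induction n) (auto simp: field_simps)
    have "(\<Sum>j<M. real j * (\<Sum>h=1..<M. (real M - real h) * cos (2 * real h * y j)))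
        = (\<Sum>h=1..<M. (real M - real h) * (\<Sum>j<M. real j * cos (2 * real h * y j)))"
      unfolding sum_distrib_left by (subst sum.swap) (simp add: mult_ac)
    also have "\<dots> = (\<Sum>h=1..<M. (real M - real h) *
       (- real M / 2 * (cos (2 * pi * real h * x) + cot (b h) * sin (2 * pi * real h * x))))"
      unfolding angle b_def by (intro sum.cong refl, subst rational_angle_sums(3)) auto
    also have "\<dots> = - real M / 2 * (\<Sum>h=1..<M. (real M - real h) *
       (cos (2 * pi * real h * x) + cot (b h) * sin (2 * pi * real h * x)))"
      unfolding sum_distrib_left by (simp add: mult_ac)
    finally have *: "(\<Sum>j<M. real j * (\<Sum>h=1..<M. (real M - real h) * cos (2 * real h * y j))) = \<dots>" .
    have "(\<Sum>j<M. real j * K (y j)) = real M * (\<Sum>j<M. real j)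
       + 2 * (\<Sum>j<M. real j * (\<Sum>h=1..<M. (real M - real h) * cos (2 * real h * y j)))"
      by (simp add: K_def algebra_simps sum.distrib sum_distrib_left)
    then show ?thesis unfolding * lin by (simp add: algebra_simps)
  qed
  \<comment> \<open>The frequency \<open>M\<close> cancels against the halved last term of
    \<open>real M * Q (y 0)\<close>.\<close>
  also have "real M / 2 * sin (2 * pi * real M * x) - (pi * x * (real M)\<^sup>2 - pi / real M * (real M * (real M * (real M - 1) / 2 -
      (\<Sum>h=1..<M. (real M - real h) * (cos (2 * pi * real h * x) + cot (b h) * sin (2 * pi * real h * x))))))
      + pi * K (y 0) - real M * Q (y 0)
    = pi * (real M * (real M + 1) / 2 - x * (real M)\<^sup>2) + (\<Sum>h=1..<M.
       pi * (real M - real h) * (2 * cos (2 * pi * real h * x))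
       - pi * (real M - real h) * (cos (2 * pi * real h * x) + cot (b h) * sin (2 * pi * real h * x))
       - real M * sin (2 * pi * real h * x))"
    using assms(2)
    by (simp add: K_def Q_def y_def sum.distrib sum_subtractf sum_distrib_left algebra_simps add_divide_distrib diff_divide_distrib)
  also have "\<dots> = pi * (real M)\<^sup>2 * (sawtooth_majorant M x - (x - 1 / 2))"
  proof -
    have "pi * (real M)\<^sup>2 * (vaaler_cos M h * cos t - vaaler_sin M h * sin t)
       = pi * (real M - real h) * (2 * cos t) - pi * (real M - real h) * (cos t + cot (b h) * sin t) - real M * sin t" for h t
      using assms(2) by (simp add: vaaler_cos_def vaaler_sin_def b_def field_simps power2_eq_square)
    then show ?thesis
      unfolding sawtooth_majorant_def using assms(2)
      by (simp add: distrib_left sum_distrib_left right_diff_distrib[where b="1 / (2 * real M) + _"])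
         (simp add: algebra_simps power2_eq_square)
  qed
  finally show ?thesis unfolding S_def by simp
qed

text \<open>The points \<open>y 0 > ... > y M\<close> have spacing \<open>pi / M\<close>, and the
  tangent to \<open>t cot t\<close> at the left end of each step bounds its increment. The
  increments telescope to \<open>pi * cot (pi * x)\<close>, because
  \<open>y M = y 0 - pi\<close>.\<close>

lemma sawtooth_majorant_ge_generic:
  assumes "sin (pi * real M * x) \<noteq> 0" "M > 0" "0 < x" "x < 1"
  shows "sawtooth_majorant M x \<ge> x - 1 / 2"
proof -
  define y where "y j = pi * (x - real j / real M)" for j
  define g where "g t = cot t - t / (sin t)\<^sup>2" for t :: real
  define f where "f t = t * cot t" for t :: real
  have nz: "y j \<noteq> 0" for j
    using assms by (auto simp: y_def)
  have step: "f (y j) - f (y (Suc j)) \<le> g (y (Suc j)) * (pi / real M)" if "j < M" for j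
  proof -
    have "real (Suc j) / real M \<le> 1" using that by simp
    then have "- 1 < x - real (Suc j) / real M" using assms(3) by linarith
    then have "pi * (- 1) < y (Suc j)" unfolding y_def by (intro mult_strict_left_mono) auto
    moreover have "x - real j / real M < 1" using assms(4) by (smt (verit) divide_nonneg_nonneg of_nat_0_le_iff)
    then have "y j < pi * 1" unfolding y_def by (intro mult_strict_left_mono) auto
    moreover have diff: "y j - y (Suc j) = pi / real M"
      by (simp add: y_def algebra_simps add_divide_distrib)
    then have "y (Suc j) < y j" using assms(2) by (smt (verit) divide_pos_pos of_nat_0_less_iff pi_gt_zero)
    ultimately show ?thesis using mult_cot_below_tangent[of "y (Suc j)" "y j"] nz
      by (simp add: f_def g_def diff)
  qed
  have "f (y 0) - f (y M) = (\<Sum>j<M. f (y j) - f (y (Suc j)))"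
    by (rule sum_lessThan_telescope'[symmetric])
  also have "\<dots> \<le> (\<Sum>j<M. g (y (Suc j)) * (pi / real M))"
    using step by (intro sum_mono) auto
  also have "\<dots> = (\<Sum>j<M. g (y (Suc j))) * (pi / real M)"
    by (rule sum_distrib_right[symmetric])
  \<comment> \<open>Reindexing to match the interpolation formula leaves
    \<open>g (y M) - g (y 0)\<close>, the source of its term
    \<open>pi / (sin (pi * x))^2\<close>.\<close>
  also have "(\<Sum>j<M. g (y (Suc j))) = (\<Sum>j<M. g (y j)) + g (y M) - g (y 0)"
    using sum.lessThan_Suc_shift[of "\<lambda>j. g (y j)" M] by simp
  also have yM: "y M = pi * x - pi" and y0: "y 0 = pi * x"
    using assms by (simp_all add: y_def algebra_simps)
  have per: "sin (pi * x - pi) = - sin (pi * x)" "cot (pi * x - pi) = cot (pi * x)"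
    by (simp_all add: cot_def sin_diff cos_diff)
  have "g (y M) - g (y 0) = pi / (sin (pi * x))\<^sup>2"
    unfolding g_def yM y0 per by (simp add: diff_divide_distrib)
  moreover have "f (y 0) - f (y M) = pi * cot (pi * x)"
    unfolding f_def yM y0 per by (simp add: algebra_simps)
  ultimately have "pi * cot (pi * x) \<le> ((\<Sum>j<M. g (y j)) + pi / (sin (pi * x))\<^sup>2) * (pi / real M)"
    by (simp add: add_diff_eq[symmetric])
  also have "\<dots> = pi * (((\<Sum>j<M. g (y j)) + pi / (sin (pi * x))\<^sup>2) / real M)"
    by simp
  finally have "cot (pi * x) \<le> ((\<Sum>j<M. g (y j)) + pi / (sin (pi * x))\<^sup>2) / real M"
    by (rule mult_left_le_imp_le) simp
  then have "0 \<le> (\<Sum>j<M. g (y j)) + pi / (sin (pi * x))\<^sup>2 - real M * cot (pi * x)"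
    using assms(2) by (simp add: pos_le_divide_eq mult.commute)
  then have "0 \<le> pi * (real M)\<^sup>2 * (sawtooth_majorant M x - (x - 1 / 2))"
    using sawtooth_majorant_interpolation[OF assms(1,2)] unfolding g_def y_def by simp
  moreover have "0 < pi * (real M)\<^sup>2" using assms(2) by simp
  ultimately show ?thesis by (simp only: zero_le_mult_iff) auto
qed

text \<open>The generic points are dense in \<open>[0, 1]\<close> and both sides are continuous. The
  value at \<open>x = 1\<close> covers the left limit of the sawtooth at an integer.\<close>

lemma sawtooth_majorant_ge:
  assumes "M > 0" "0 \<le> x" "x \<le> 1"
  shows "sawtooth_majorant M x \<ge> x - 1 / 2"
proof -
  define Z where "Z = (\<lambda>k::nat. real k / real M) ` {..M}"
  have "interior Z = {}" by (intro empty_interior_finite) (simp add: Z_def)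
  then have "{0<..<1} \<inter> closure (- Z) = {0<..<1::real}" by (simp add: closure_complement)
  then have "{0<..<1} \<subseteq> closure ({0<..<1} \<inter> - Z)"
    using open_Int_closure_subset[of "{0<..<1}" "- Z"] by auto
  also have "\<dots> \<subseteq> closure ({0..1} - Z)" by (intro closure_mono) auto
  finally have "closure {0<..<1} \<subseteq> closure ({0..1} - Z)" by (rule closure_minimal) simp
  then have "{0..1} \<subseteq> closure ({0..1} - Z)" by simp
  moreover have "closed {x. x - 1 / 2 \<le> sawtooth_majorant M x}"
    unfolding sawtooth_majorant_def by (intro closed_Collect_le continuous_intros)
  moreover have "{0..1} - Z \<subseteq> {x. x - 1 / 2 \<le> sawtooth_majorant M x}"
  proof
    fix x assume x: "x \<in> {0..1} - Z"
    have "sin (pi * real M * x) \<noteq> 0"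
    proof
      assume "sin (pi * real M * x) = 0"
      then obtain k :: int where "pi * real M * x = of_int k * pi" by (auto simp: sin_zero_iff_int2)
      then have k: "x = of_int k / real M" using assms(1) by (simp add: field_simps)
      then have "0 \<le> k" "k \<le> int M" using x assms(1) by (auto simp: zero_le_divide_iff)
      then have "x = real (nat k) / real M" "nat k \<le> M" using k by auto
      then show False using x unfolding Z_def by blast
    qed
    moreover have "x \<noteq> 0" "x \<noteq> 1" using calculation by auto
    ultimately show "x \<in> {x. x - 1 / 2 \<le> sawtooth_majorant M x}"
      using x assms(1) by (auto intro!: sawtooth_majorant_ge_generic)
  qed
  ultimately have "{0..1} \<subseteq> {x. x - 1 / 2 \<le> sawtooth_majorant M x}"
    using closure_minimal by blast
  then show ?thesis using assms by auto
qed

section \<open>Bounds for the coefficients\<close>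

lemma vaaler_cos_nonneg: "h < M \<Longrightarrow> 0 \<le> vaaler_cos M h"
  by (simp add: vaaler_cos_def)

text \<open>The cotangent is negative when \<open>h / M > 1 / 2\<close>; the reflection to
  \<open>s\<close> turns the claim into \<open>s * cot s \<le> 1\<close>.\<close>

lemma vaaler_sin_nonneg:
  assumes "0 < h" "h < M"
  shows "0 \<le> vaaler_sin M h"
proof -
  define s where "s = pi * (1 - real h / real M)"
  have "0 < s" "s < pi" using assms by (simp_all add: s_def)
  then have "s * cot s \<le> 1" by (rule mult_cot_le_one)
  moreover have "pi * real h / real M = pi - s" by (simp add: s_def algebra_simps)
  moreover have "cot (pi - s) = - cot s" by (simp add: cot_def)
  ultimately show ?thesis using assms unfolding vaaler_sin_def s_def
    by (simp add: field_simps)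
qed

text \<open>After \<open>t cot (\<pi> t) \<le> 1 / \<pi>\<close> with \<open>t = h / M\<close>, the claim is the quadratic inequality
  \<open>2 / \<pi> \<le> c - c t + 2 t\<^sup>2\<close>, whose discriminant condition for this \<open>c\<close> is \<open>16 \<le> 7 \<pi>\<close>.\<close>

lemma vaaler_coeff_sum_le:
  assumes "0 < h" "h < M" and c: "c = 16 / (7 * pi)"
  shows "2 * (vaaler_cos M h + vaaler_sin M h) \<le> (2 - c) / real M + c / real h"
proof -
  define t where "t = real h / real M"
  have t: "0 < t" "t < 1" using assms by (simp_all add: t_def)
  have "pi * t * cot (pi * t) \<le> 1" using t by (intro mult_cot_le_one) auto
  then have cot: "t * cot (pi * t) \<le> 1 / pi" by (simp add: field_simps)
  define q where "q = 1 / pi"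
  have "c\<^sup>2 / 8 \<le> c - 2 / pi"
  proof -
    have "16 \<le> 7 * pi" using pi_approx by simp
    then have "16 * pi \<le> 7 * pi * pi" by simp
    then show ?thesis unfolding c by (simp add: field_simps power2_eq_square)
  qed
  moreover have "c * t - 2 * t\<^sup>2 \<le> c\<^sup>2 / 8"
    using zero_le_power2[of "4 * t - c"] by (simp add: power2_eq_square algebra_simps)
  ultimately have "2 / pi \<le> c - c * t + 2 * t\<^sup>2" by linarith
  moreover have "(1 - t) * (t * cot (pi * t)) \<le> (1 - t) * q"
    using cot t unfolding q_def by (intro mult_left_mono) auto
  moreover have "2 / pi = 2 * q" by (simp add: q_def)
  ultimately have "t * (2 * ((1 - t) + ((1 - t) * cot (pi * t) + q))) \<le> t * ((2 - c) + c / t)"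
    using t by (simp add: algebra_simps power2_eq_square)
  then have "2 * ((1 - t) + ((1 - t) * cot (pi * t) + 1 / pi)) \<le> (2 - c) + c / t"
    using t unfolding q_def by simp
  then have "2 * ((1 - t) + ((1 - t) * cot (pi * t) + 1 / pi)) / real M \<le> ((2 - c) + c / t) / real M"
    by (rule divide_right_mono) simp
  moreover have "((2 - c) + c / t) / real M = (2 - c) / real M + c / real h"
    using assms by (simp add: t_def field_simps)
  moreover have "2 * ((1 - t) + ((1 - t) * cot (pi * t) + 1 / pi)) / real M = 2 * (vaaler_cos M h + vaaler_sin M h)"
    unfolding vaaler_cos_def vaaler_sin_def t_def[symmetric] times_divide_eq_right[symmetric]
    by (simp add: add_divide_distrib)
  ultimately show ?thesis by simp
qed

section \<open>Majorant and minorant of the indicator of an interval modulo 1\<close>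

text \<open>Integer shifts bring all arguments into \<open>[0, 1]\<close>. The two sawtooth bounds
  then add up to the indicator minus \<open>b - a\<close> for the majorant, and to its negative for
  the minorant. If \<open>x\<close> is congruent to an endpoint, an argument may land on 0 or 1,
  which the closed range in \<open>sawtooth_majorant_ge\<close> allows.\<close>

lemma indicator_majorant:
  assumes "M > 0" "a \<le> b" "b \<le> a + 1"
  shows "of_bool (in_interval_mod1 x a b) \<le> b - a + sawtooth_majorant M (x - b) + sawtooth_majorant M (a - x)"
    (is ?upper)
  and "of_bool (in_interval_mod1 x a b) \<ge> b - a - sawtooth_majorant M (b - x) - sawtooth_majorant M (x - a)"
    (is ?lower)
proof -
  have maj: "sawtooth_majorant M y \<ge> y + z - 1 / 2" if "z \<in> \<int>" "0 \<le> y + z" "y + z \<le> 1" for y z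
    using sawtooth_majorant_ge[OF assms(1) that(2,3)] sawtooth_majorant_periodic[OF that(1), of M y] by simp
  have "?upper \<and> ?lower"
  proof (cases "in_interval_mod1 x a b")
    case True
    then obtain z where z: "a \<le> z" "z \<le> b" "x - z \<in> \<int>" by (auto simp: in_interval_mod1_def)
    then have "z - x \<in> \<int>" by (metis Ints_minus minus_diff_eq)
    then show ?thesis
      using True assms z maj[of "1 + (z - x)" "x - b"] maj[of "1 + (x - z)" "a - x"]
        maj[of "x - z" "b - x"] maj[of "z - x" "x - a"] by simp
  next
    case False
    \<comment> \<open>The representative \<open>x - k\<close> lies in \<open>[a, a + 1)\<close>,
      hence beyond \<open>b\<close>.\<close>
    define k :: real where "k = of_int \<lfloor>x - a\<rfloor>"
    have k: "k \<in> \<int>" "a \<le> x - k" "x - k < a + 1" unfolding k_def by (simp, linarith+)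
    then have "\<not> x - k \<le> b" using False unfolding in_interval_mod1_def
      by (metis diff_diff_eq2 add_diff_cancel_left')
    then show ?thesis
      using False assms k maj[of "- k" "x - b"] maj[of "1 + k" "a - x"]
        maj[of "1 + k" "b - x"] maj[of "- k" "x - a"] by simp
  qed
  then show ?upper ?lower by auto
qed

section \<open>Twisted exponential sums and summation by parts\<close>

lemma summation_by_parts_norm_le:
  fixes z w :: "nat \<Rightarrow> complex"
  assumes "N \<ge> 1" and bound: "\<And>T. T \<in> {1..N} \<Longrightarrow> norm (\<Sum>n=1..T. z n) \<le> K"
  shows "norm (\<Sum>n=1..N. z n * w n) \<le> K * (norm (w N) + (\<Sum>n=1..<N. norm (w (n + 1) - w n)))"
proof -
  define S where "S T = (\<Sum>n=1..T. z n)" for T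
  have "(\<Sum>n=1..N. z n * w n) = S N * w N - (\<Sum>n=1..<N. S n * (w (n + 1) - w n))"
    using assms(1)
  proof (induction N rule: dec_induct)
    case (step N)
    then show ?case by (simp add: S_def algebra_simps)
  qed (simp add: S_def)
  also have "norm \<dots> \<le> norm (S N * w N) + (\<Sum>n=1..<N. norm (S n * (w (n + 1) - w n)))"
    by (intro order_trans[OF norm_triangle_ineq4] add_left_mono norm_sum)
  also have "\<dots> \<le> K * norm (w N) + (\<Sum>n=1..<N. K * norm (w (n + 1) - w n))"
    unfolding norm_mult S_def using assms(1)
    by (intro add_mono sum_mono mult_right_mono bound) auto
  finally show ?thesis by (simp add: distrib_left sum_distrib_left)
qed

lemma e_unit_cis: "e_unit y = cis (2 * pi * y)"
  by (simp add: e_unit_def cis_conv_exp mult_ac)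

lemma e_unit_diff_le:
  "norm (e_unit (real h * x) - e_unit (real h * y)) \<le> 2 * pi * real h * dist_int (x - y)"
proof -
  obtain z :: int where z: "dist_int (x - y) = \<bar>x - y - of_int z\<bar>"
    using dist_int_is_min by blast
  define t where "t = real h * (x - y - of_int z)"
  \<comment> \<open>Since \<open>h\<close> is an integer, moving \<open>x\<close> by the nearest
    integer \<open>z\<close> leaves the value unchanged; then the chord is bounded by the
    arc.\<close>
  have "e_unit (real h * x) = e_unit (real h * y) * e_unit t * e_unit (of_int (int h * z))"
    by (simp add: e_unit_cis cis_mult t_def algebra_simps)
  also have "e_unit (of_int m) = 1" for m
    using cis_multiple_2pi[of "of_int m"] by (simp add: e_unit_cis)
  finally have "norm (e_unit (real h * x) - e_unit (real h * y)) = norm (e_unit (real h * y) * (e_unit t - 1))"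
    by (simp add: algebra_simps)
  also have "\<dots> = norm (exp (\<i> * of_real (2 * pi * t)) - 1)"
    by (simp add: norm_mult e_unit_cis cis_conv_exp)
  also have "\<dots> = 2 * \<bar>sin (pi * t)\<bar>"
    using dist_exp_i_1[of "2 * pi * t"] by (simp add: dist_norm)
  also have "\<dots> \<le> 2 * \<bar>pi * t\<bar>"
    by (intro mult_left_mono abs_sin_x_le_abs_x) simp
  also have "\<dots> = 2 * pi * real h * dist_int (x - y)"
    by (simp add: t_def z abs_mult)
  finally show ?thesis .
qed

lemma max_exp_sum_nonneg:
  assumes "N \<ge> 1"
  shows "0 \<le> max_exp_sum u N h"
proof -
  have "0 \<le> norm (\<Sum>n=1..1. e_unit (real h * u n))" by simp
  also have "\<dots> \<le> max_exp_sum u N h"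
    unfolding max_exp_sum_def using assms by (intro Max_ge imageI) auto
  finally show ?thesis .
qed

lemma shifted_exp_sum_le:
  assumes "N \<ge> 1"
  shows "norm (\<Sum>n=1..N. e_unit (real h * (u n - s n)))
    \<le> max_exp_sum u N h * (1 + 2 * pi * real h * total_variation_mod1 s N)"
proof -
  have "e_unit (real h * (u n - s n)) = e_unit (real h * u n) * cnj (e_unit (real h * s n))" for n
    by (simp add: e_unit_cis cis_cnj cis_mult algebra_simps)
  then have "norm (\<Sum>n=1..N. e_unit (real h * (u n - s n)))
     = norm (\<Sum>n=1..N. e_unit (real h * u n) * cnj (e_unit (real h * s n)))" by simp
  also have "\<dots> \<le> max_exp_sum u N h * (norm (cnj (e_unit (real h * s N)))
     + (\<Sum>n=1..<N. norm (cnj (e_unit (real h * s (n + 1))) - cnj (e_unit (real h * s n)))))"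
    using assms by (intro summation_by_parts_norm_le) (auto simp: max_exp_sum_def)
  also have "\<dots> \<le> max_exp_sum u N h * (1 + (\<Sum>n=1..<N. 2 * pi * real h * dist_int (s (n + 1) - s n)))"
  proof (intro mult_left_mono add_mono sum_mono)
    show "norm (cnj (e_unit (real h * s (n + 1))) - cnj (e_unit (real h * s n)))
       \<le> 2 * pi * real h * dist_int (s (n + 1) - s n)" for n
      using e_unit_diff_le[of h "s (n + 1)" "s n"] by (simp flip: complex_cnj_diff)
    show "0 \<le> max_exp_sum u N h" by (rule max_exp_sum_nonneg[OF assms])
  qed (simp add: e_unit_cis)
  finally show ?thesis by (simp add: total_variation_mod1_def sum_distrib_left)
qed

text \<open>The real and imaginary parts of the exponential sum are bounded separately, so the two
  coefficients add. Exchanging \<open>u\<close> and \<open>s\<close> only changes the sign \<sigma>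
  of the sine part, which the bound does not see.\<close>

lemma sum_sawtooth_majorant_le:
  fixes u s :: "nat \<Rightarrow> real" and M N :: nat
  assumes "N \<ge> 1"
  defines "R \<equiv> real N / (2 * real M) + (\<Sum>h=1..<M. (vaaler_cos M h + vaaler_sin M h)
     * (max_exp_sum u N h * (1 + 2 * pi * real h * total_variation_mod1 s N)))"
  shows "(\<Sum>n=1..N. sawtooth_majorant M (u n - s n)) \<le> R"
    and "(\<Sum>n=1..N. sawtooth_majorant M (s n - u n)) \<le> R"
proof -
  define E where "E h = (\<Sum>n=1..N. e_unit (real h * (u n - s n)))" for h
  have cos: "(\<Sum>n=1..N. cos (2 * pi * real h * (u n - s n))) = Re (E h)" for h
    by (simp add: E_def e_unit_cis mult_ac)
  have sin: "(\<Sum>n=1..N. sin (2 * pi * real h * (u n - s n))) = Im (E h)" for h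
    by (simp add: E_def e_unit_cis mult_ac)
  have E: "\<bar>Re (E h)\<bar> \<le> max_exp_sum u N h * (1 + 2 * pi * real h * total_variation_mod1 s N)"
      "\<bar>Im (E h)\<bar> \<le> max_exp_sum u N h * (1 + 2 * pi * real h * total_variation_mod1 s N)" for h
    using shifted_exp_sum_le[OF assms(1), of h u s] abs_Re_le_cmod[of "E h"] abs_Im_le_cmod[of "E h"]
    unfolding E_def by linarith+
  have bound: "real N / (2 * real M) + (\<Sum>h=1..<M. vaaler_cos M h * Re (E h) - \<sigma> * vaaler_sin M h * Im (E h)) \<le> R"
    if "\<bar>\<sigma>\<bar> = 1" for \<sigma>
    unfolding R_def
  proof (intro add_left_mono sum_mono)
    fix h assume h: "h \<in> {1..<M}"
    define B where "B = max_exp_sum u N h * (1 + 2 * pi * real h * total_variation_mod1 s N)"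
    have "vaaler_cos M h * Re (E h) \<le> vaaler_cos M h * B"
      using E(1)[of h] h by (intro mult_left_mono vaaler_cos_nonneg) (auto simp: B_def)
    moreover have "\<bar>\<sigma> * Im (E h)\<bar> \<le> B"
      using E(2)[of h] that by (simp add: abs_mult B_def)
    then have "vaaler_sin M h * (- (\<sigma> * Im (E h))) \<le> vaaler_sin M h * B"
      using h by (intro mult_left_mono vaaler_sin_nonneg) auto
    ultimately show "vaaler_cos M h * Re (E h) - \<sigma> * vaaler_sin M h * Im (E h) \<le> (vaaler_cos M h + vaaler_sin M h) * B"
      by (simp add: algebra_simps)
  qed
  have "(\<Sum>n=1..N. sawtooth_majorant M (u n - s n)) = real N / (2 * real M) +
     (\<Sum>h=1..<M. vaaler_cos M h * Re (E h) - 1 * vaaler_sin M h * Im (E h))"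
    unfolding sawtooth_majorant_def sum.distrib
    by (subst sum.swap) (simp add: sum_subtractf sum_distrib_left[symmetric] cos[simplified] sin[simplified])
  with bound[of 1] show "(\<Sum>n=1..N. sawtooth_majorant M (u n - s n)) \<le> R" by simp
  have flip: "2 * pi * real h * (s n - u n) = - (2 * pi * real h * (u n - s n))" for h n
    by (simp add: algebra_simps)
  have "(\<Sum>n=1..N. sawtooth_majorant M (s n - u n)) = real N / (2 * real M) +
     (\<Sum>h=1..<M. vaaler_cos M h * Re (E h) - (- 1) * vaaler_sin M h * Im (E h))"
    unfolding sawtooth_majorant_def sum.distrib flip cos_minus sin_minus
    by (subst sum.swap) (simp add: sum.distrib sum_distrib_left[symmetric] cos[simplified] sin[simplified])
  with bound[of "- 1"] show "(\<Sum>n=1..N. sawtooth_majorant M (s n - u n)) \<le> R" by simp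
qed

section \<open>The discrepancy bound\<close>

theorem theorem1p2:
  fixes u \<alpha> \<beta> :: "nat \<Rightarrow> real" and N H :: nat and c :: real
  assumes "\<And>n. n \<ge> 1 \<Longrightarrow> \<alpha> n \<le> \<beta> n \<and> \<beta> n \<le> \<alpha> n + 1"
    and "N \<ge> 1" and "H \<ge> 1"
    and "c = 16 / (7 * pi)"
  shows "\<bar>discrepancy u \<alpha> \<beta> N\<bar> \<le>
    real N / (real H + 1) +
    (\<Sum>h=1..H. (1 + pi * real h * (total_variation_mod1 \<alpha> N + total_variation_mod1 \<beta> N))
       * ((2 - c) / (real H + 1) + c / real h) * max_exp_sum u N h)"
proof -
  define M where "M = Suc H"
  define R where "R s = real N / (2 * real M) + (\<Sum>h=1..<M. (vaaler_cos M h + vaaler_sin M h)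
     * (max_exp_sum u N h * (1 + 2 * pi * real h * total_variation_mod1 s N)))" for s
  note R = sum_sawtooth_majorant_le[OF assms(2), where M=M and u=u, folded R_def]
  have M: "M > 0" by (simp add: M_def)
  have D: "discrepancy u \<alpha> \<beta> N = (\<Sum>n=1..N. of_bool (in_interval_mod1 (u n) (\<alpha> n) (\<beta> n)) - (\<beta> n - \<alpha> n))"
    by (simp add: discrepancy_def count_mod1_def sum_subtractf sum.If_cases of_bool_def Int_def)
  have "discrepancy u \<alpha> \<beta> N \<le>
      (\<Sum>n=1..N. sawtooth_majorant M (u n - \<beta> n) + sawtooth_majorant M (\<alpha> n - u n))"
    unfolding D using indicator_majorant(1)[OF M] assms(1) by (intro sum_mono) (smt (verit) atLeastAtMost_iff)
  also have "\<dots> \<le> R \<beta> + R \<alpha>"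
    unfolding sum.distrib by (intro add_mono R)
  finally have upper: "discrepancy u \<alpha> \<beta> N \<le> R \<alpha> + R \<beta>" by simp
  have "- discrepancy u \<alpha> \<beta> N \<le>
      (\<Sum>n=1..N. sawtooth_majorant M (\<beta> n - u n) + sawtooth_majorant M (u n - \<alpha> n))"
    unfolding D sum_negf[symmetric] using indicator_majorant(2)[OF M] assms(1)
    by (intro sum_mono) (smt (verit) atLeastAtMost_iff)
  also have "\<dots> \<le> R \<beta> + R \<alpha>"
    unfolding sum.distrib by (intro add_mono R)
  finally have "\<bar>discrepancy u \<alpha> \<beta> N\<bar> \<le> R \<alpha> + R \<beta>" using upper by simp
  \<comment> \<open>The factors \<open>1 + 2 * pi * h * V\<close> for \<alpha> and \<beta> add to
    twice \<open>1 + pi * h * (V + V')\<close>; this 2 goes to the coefficients, as in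
    \<open>vaaler_coeff_sum_le\<close>.\<close>
  also have "\<dots> = real N / real M + (\<Sum>h=1..<M. (1 + pi * real h * (total_variation_mod1 \<alpha> N + total_variation_mod1 \<beta> N))
       * (2 * (vaaler_cos M h + vaaler_sin M h)) * max_exp_sum u N h)"
    unfolding R_def by (simp add: algebra_simps sum.distrib sum_distrib_left)
  also have "\<dots> \<le> real N / real M + (\<Sum>h=1..<M. (1 + pi * real h * (total_variation_mod1 \<alpha> N + total_variation_mod1 \<beta> N))
       * ((2 - c) / real M + c / real h) * max_exp_sum u N h)"
  proof (intro add_left_mono sum_mono mult_right_mono mult_left_mono)
    fix h assume h: "h \<in> {1..<M}"
    then show "2 * (vaaler_cos M h + vaaler_sin M h) \<le> (2 - c) / real M + c / real h"
      using vaaler_coeff_sum_le assms(4) by simp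
    have "0 \<le> total_variation_mod1 s N" for s
      unfolding total_variation_mod1_def using dist_int_is_min by (intro sum_nonneg) (metis abs_ge_zero)
    then show "0 \<le> 1 + pi * real h * (total_variation_mod1 \<alpha> N + total_variation_mod1 \<beta> N)" by simp
    show "0 \<le> max_exp_sum u N h" by (rule max_exp_sum_nonneg[OF assms(2)])
  qed
  finally show ?thesis by (simp add: M_def atLeastLessThanSuc_atLeastAtMost add.commute)
qed

end
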